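(* Let $a>0$ and $\Omega=[a,a+1]^2\subset\mathbb{R}^2$. Let $u:\Omega\to[0,\infty)$ be convex and coordinatewise nondecreasing, and suppose there are real constants $t_{0.5}<t_{1.5}$ and $C_0$ such that the three sets $$\Omega_0=\{(x_1,x_2)\in\Omega: x_1+x_2\le t_{0.5}\},$$ $$\Omega_1=\{(x_1,x_2)\in\Omega: t_{0.5}<x_1+x_2\le t_{1.5}\},$$ $$\Omega_2=\{(x_1,x_2)\in\Omega: t_{1.5}<x_1+x_2\}$$ are all nonempty and the following hold. (i) $u=0$ on $\Omega_0$. (ii) On $\Omega_1$, $u(x_1,x_2)=u_1(x_1,x_2):=U(x_1+x_2)$, where $$U(t)=\tfrac38t^2-\tfrac12at-\tfrac12\log|t-2a|+C_0,$$ and the constants $C_0,t_{0.5}$ are such that $U(t_{0.5})=0=U'(t_{0.5})$. (iii) On $\Omega_2$, $u=u_2$ is strictly convex and satisfies $$\Delta u_2=\frac{\partial^2u_2}{\partial x_1^2}+\frac{\partial^2u_2}{\partial x_2^2}=3\quad\text{on } \mathrm{Int}(\Omega_2),$$ $$(Du_2(x)-x)\cdot\hat n(x)=0\quad\text{on }\partial\Omega_2\cap\partial\Omega,$$ $$u_2-u_1=0\quad\text{on }\partial\Omega_1\cap\partial\Omega_2,$$ $$D(u_2-u_1)\cdot\hat n(x)=0\quad\text{on }\partial\Omega_1\cap\partial\Omega_2.$$ Then $u\notin C^1(\Omega)$. Hence $u$ does not maximize the functional $$\Phi[w]=\int_{\Omega}\left[x\cdot Dw(x)-w(x)-\tfrac12|Dw(x)|^2\right]dx$$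 among convex, coordinatewise nondecreasing functions $w:\mathbb{R}^2\to[0,\infty]$; that is, no such $w$ with $w|_\Omega=u$ is a maximizer of $\Phi$ in this class.
   Context: $\mathrm{Int}(\Omega_2)$ is the interior of $\Omega_2$, and $\hat n(x)$ denotes the outer unit normal to $\mathrm{Int}(\Omega_2)$ at $x\in\partial\Omega_2$. Boundary conditions involving $\hat n$ are understood at the boundary points where $\hat n$ is defined (i.e. away from the corners of $\Omega_2$), with $Du_2$ at a boundary point denoting the limit of the gradient from $\mathrm{Int}(\Omega_2)$. $Du$ denotes the gradient. $C^1(\Omega)$ means continuously differentiable up to the boundary: $u$ is continuous on the closed square $\Omega$, is $C^1$ on its interior, and $Du$ extends continuously to all of $\Omega$. Coordinatewise nondecreasing means $u(x)\le u(y)$ whenever $x_i\le y_i$ for $i=1,2$. The functional $\Phi$ is the monopolist's profit functional $\Phi[w]=\int [x\cdot Dw-w-c(Dw)]\,d\mu$ with cost $c(y)=|y|^2/2$ and $d\mu(x)=1_\Omega(x)\,dx$ (the uniform distribution on $\Omega$). A convex function that is finite almost everywhere on $\Omega$ is differentiable almost everywhere there, so the integrand is defined almost everywhere; by convention $\Phi[w]=-\infty$ if $w=\infty$ on a subset of $\Omega$ of positive measure. *)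

theory Defs
  imports "HOL-Analysis.Analysis"
begin

section \<open>Calculus on subsets of Euclidean space\<close>

definition strictly_convex_on :: "'a::real_vector set \<Rightarrow> ('a \<Rightarrow> real) \<Rightarrow> bool" where
  "strictly_convex_on S f \<longleftrightarrow>
     convex S \<and>
     (\<forall>x\<in>S. \<forall>y\<in>S. \<forall>u>0. \<forall>v>0. x \<noteq> y \<and> u + v = 1 \<longrightarrow>
        f (u *\<^sub>R x + v *\<^sub>R y) < u * f x + v * f y)"

definition has_partial :: "(real^'n \<Rightarrow> real) \<Rightarrow> 'n \<Rightarrow> real \<Rightarrow> real^'n \<Rightarrow> bool" where
  "has_partial f i d x \<longleftrightarrow>
     ((\<lambda>t. f (x + t *\<^sub>R axis i 1)) has_real_derivative d) (at 0)"

text \<open>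
  The second partial derivatives are only required to exist pointwise on the open set \<open>S\<close>,
  with \<open>F i\<close> and \<open>H i\<close> being the first and second partial derivatives in direction \<open>i\<close>.
\<close>

definition has_laplacian_on :: "(real^'n \<Rightarrow> real) \<Rightarrow> (real^'n \<Rightarrow> real) \<Rightarrow> (real^'n) set \<Rightarrow> bool" where
  "has_laplacian_on f g S \<longleftrightarrow>
     (\<exists>F H. \<forall>x\<in>S.
        (\<forall>i. has_partial f i (F i x) x \<and> has_partial (F i) i (H i x) x) \<and>
        (\<Sum>i\<in>UNIV. H i x) = g x)"

text \<open>
  The gradient of \<open>f\<close> at a boundary point \<open>x\<close> of the open set \<open>S\<close>, as a limit from \<open>S\<close>.
\<close>

definition has_boundary_gradient ::
    "('a::real_inner \<Rightarrow> real) \<Rightarrow> 'a set \<Rightarrow> 'a \<Rightarrow> 'a \<Rightarrow> bool" where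
  "has_boundary_gradient f S x p \<longleftrightarrow>
     (\<exists>G. (\<forall>y\<in>S. GDERIV f y :> G y) \<and> (G \<longlongrightarrow> p) (at x within S))"

text \<open>
  For an open convex set \<open>S\<close> and \<open>x \<in> frontier S\<close>: the outer normal cone at \<open>x\<close> contains exactly
  one unit vector, namely \<open>n\<close>. At corners there are several such unit vectors,
  so no \<open>n\<close> qualifies there.
\<close>

definition is_outer_unit_normal :: "'a::real_inner set \<Rightarrow> 'a \<Rightarrow> 'a \<Rightarrow> bool" where
  "is_outer_unit_normal S x n \<longleftrightarrow>
     (\<forall>m. (norm m = 1 \<and> (\<forall>y\<in>S. m \<bullet> (y - x) \<le> 0)) \<longleftrightarrow> m = n)"

definition C1_up_to_boundary :: "'a::real_inner set \<Rightarrow> ('a \<Rightarrow> real) \<Rightarrow> bool" where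
  "C1_up_to_boundary S f \<longleftrightarrow>
     continuous_on S f \<and>
     (\<exists>G. continuous_on S G \<and> (\<forall>x\<in>interior S. GDERIV f x :> G x))"


section \<open>The square and its three regions\<close>

definition Square :: "real \<Rightarrow> (real^2) set" where
  "Square a = cbox (vec a) (vec (a + 1))"

definition Region0 :: "real \<Rightarrow> real \<Rightarrow> (real^2) set" where
  "Region0 a t05 = {x \<in> Square a. x$1 + x$2 \<le> t05}"

definition Region1 :: "real \<Rightarrow> real \<Rightarrow> real \<Rightarrow> (real^2) set" where
  "Region1 a t05 t15 = {x \<in> Square a. t05 < x$1 + x$2 \<and> x$1 + x$2 \<le> t15}"

definition Region2 :: "real \<Rightarrow> real \<Rightarrow> (real^2) set" where
  "Region2 a t15 = {x \<in> Square a. t15 < x$1 + x$2}"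

text \<open>
  At \<open>t = 2 * a\<close> the convention \<open>ln 0 = 0\<close> gives \<open>Uprof\<close> a meaningless value, but it
  is not differentiable there, so \<open>U'(t\<^sub>0\<^sub>.\<^sub>5) = 0\<close> excludes \<open>t\<^sub>0\<^sub>.\<^sub>5 = 2 * a\<close>.
\<close>

definition Uprof :: "real \<Rightarrow> real \<Rightarrow> real \<Rightarrow> real" where
  "Uprof a C0 t = 3/8 * t\<^sup>2 - 1/2 * a * t - 1/2 * ln \<bar>t - 2 * a\<bar> + C0"

definition u1 :: "real \<Rightarrow> real \<Rightarrow> real^2 \<Rightarrow> real" where
  "u1 a C0 x = Uprof a C0 (x$1 + x$2)"


section \<open>The profit functional\<close>

definition ext_convex :: "('a::real_vector \<Rightarrow> ennreal) \<Rightarrow> bool" where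
  "ext_convex w \<longleftrightarrow>
     (\<forall>x y. \<forall>u>0. \<forall>v>0. u + v = 1 \<longrightarrow>
        w (u *\<^sub>R x + v *\<^sub>R y) \<le> ennreal u * w x + ennreal v * w y)"

text \<open>The order on \<open>real^2\<close> is the coordinatewise one.\<close>

definition admissible :: "(real^2 \<Rightarrow> ennreal) set" where
  "admissible = {w. ext_convex w \<and> mono w}"

text \<open>
  Only meaningful where the finite-valued function \<open>enn2real \<circ> w\<close> is differentiable; if a convex
  \<open>w\<close> is finite almost everywhere on a square, this is the case almost everywhere there.
\<close>

definition grad :: "('a::real_inner \<Rightarrow> ennreal) \<Rightarrow> 'a \<Rightarrow> 'a" where
  "grad w x = (THE D. GDERIV (\<lambda>y. enn2real (w y)) x :> D)"

definition profit_density :: "(real^2 \<Rightarrow> ennreal) \<Rightarrow> real^2 \<Rightarrow> real" where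
  "profit_density w x = x \<bullet> grad w x - enn2real (w x) - 1/2 * (norm (grad w x))\<^sup>2"

text \<open>
  The integral is the difference of the integrals of the positive and negative parts
  (\<open>ennreal\<close> truncates negative numbers to 0). For admissible \<open>w\<close> the positive part is bounded
  by \<open>(norm x)\<^sup>2 / 2\<close> almost everywhere, so the value lies in \<open>[-\<infinity>, \<infinity>)\<close> and
  no \<open>\<infinity> - \<infinity>\<close> occurs.
\<close>

definition Profit :: "real \<Rightarrow> (real^2 \<Rightarrow> ennreal) \<Rightarrow> ereal" where
  "Profit a w =
     (if emeasure lebesgue {x \<in> Square a. w x = \<infinity>} > 0 then -\<infinity>
      else enn2ereal (\<integral>\<^sup>+x\<in>Square a. ennreal (profit_density w x) \<partial>lebesgue)
         - enn2ereal (\<integral>\<^sup>+x\<in>Square a. ennreal (- profit_density w x) \<partial>lebesgue))"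

definition is_profit_maximizer :: "real \<Rightarrow> (real^2 \<Rightarrow> ennreal) \<Rightarrow> bool" where
  "is_profit_maximizer a w \<longleftrightarrow> w \<in> admissible \<and> (\<forall>v\<in>admissible. Profit a v \<le> Profit a w)"

end

theory Submission
  imports Defs "HOL-Complex_Analysis.Conformal_Mappings"
begin

text \<open>
The problem for \<open>u\<close> on the strictly convex region is overdetermined: no function satisfies the
conditions imposed there, and both conclusions follow from this contradiction.

On the diagonal side \<open>x\<^sub>1 + x\<^sub>2 = t\<^sub>1\<^sub>.\<^sub>5\<close> of that region, both the value and the normal derivative of
\<open>u\<close> are prescribed, and they are those of the function \<open>U(x\<^sub>1 + x\<^sub>2)\<close>. This is Cauchy data for the
equation \<open>\<Delta>u = 3\<close>, so it determines \<open>u\<close>. A solution with this data is \<open>V(x\<^sub>1 + x\<^sub>2)\<close>, where \<open>V'' = 3/2\<close>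
and \<open>V\<close>, \<open>V'\<close> agree with \<open>U\<close>, \<open>U'\<close> at \<open>t\<^sub>1\<^sub>.\<^sub>5\<close>; hence \<open>Du(x) = V'(x\<^sub>1 + x\<^sub>2) (1, 1)\<close> throughout the region.
On the right side \<open>x\<^sub>1 = a + 1\<close> of the square, however, the Neumann condition makes
\<open>\<partial>u/\<partial>x\<^sub>1\<close> equal to the constant \<open>a + 1\<close>, while \<open>V'\<close> is strictly increasing.

Uniqueness comes from complex analysis. The difference \<open>h = u - V(x\<^sub>1 + x\<^sub>2)\<close> is harmonic, so
\<open>\<partial>\<^sub>1h - \<i> \<partial>\<^sub>2h\<close> is holomorphic; it tends to 0 at the diagonal. Extended by 0 across the
diagonal it stays holomorphic, because a continuous function that is holomorphic off a line is
holomorphic, and the identity theorem forces it to vanish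
(\<open>holomorphic_zero_of_zero_boundary_values_on_line\<close>).

The delicate point is that the second derivatives \<open>\<partial>\<^sub>1\<^sub>1u\<close> and \<open>\<partial>\<^sub>2\<^sub>2u\<close> are only known to
exist pointwise. Convexity repairs this: it makes the first partial derivatives continuous and the
pure second ones nonnegative, and since the latter add up to 3 they lie in \<open>[0, 3]\<close>. Bounded
pointwise derivatives are enough to differentiate under the integral sign by dominated convergence,
which is how \<open>harmonic_imp_holomorphic_gradient\<close> constructs a harmonic conjugate.
\<close>

section \<open>Directional derivatives of convex functions\<close>

lemma open_line_preimage:
  fixes S :: "'a::real_normed_vector set"
  assumes "open S"
  shows "open {t. x + t *\<^sub>R e \<in> S}"
proof -
  have "open ((\<lambda>t. x + t *\<^sub>R e) -` S)"
    using assms by (intro open_vimage) (auto intro!: continuous_intros)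
  then show ?thesis by (simp add: vimage_def)
qed

lemma convex_on_line:
  fixes f :: "'a::real_vector \<Rightarrow> real"
  assumes "convex_on S f"
  shows "convex_on {t. x + t *\<^sub>R e \<in> S} (\<lambda>t. f (x + t *\<^sub>R e))"
proof -
  have affine: "x + (u * s + v * t) *\<^sub>R e = u *\<^sub>R (x + s *\<^sub>R e) + v *\<^sub>R (x + t *\<^sub>R e)"
    if "u + v = 1" for u v s t :: real
  proof -
    have "u *\<^sub>R (x + s *\<^sub>R e) + v *\<^sub>R (x + t *\<^sub>R e) = (u + v) *\<^sub>R x + (u * s + v * t) *\<^sub>R e"
      by (simp add: algebra_simps)
    then show ?thesis using that by simp
  qed
  have S: "convex S" using assms by (simp add: convex_on_def)
  have "convex {t. x + t *\<^sub>R e \<in> S}"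
    unfolding convex_def using convexD[OF S] by (auto simp: affine)
  then show ?thesis
    using assms unfolding convex_on_def by (auto simp: affine)
qed

lemma convex_ge_directional_tangent:
  fixes f :: "'a::real_normed_vector \<Rightarrow> real"
  assumes "open S" and conv: "convex_on S f"
    and der: "((\<lambda>t. f (x + t *\<^sub>R e)) has_real_derivative d) (at 0)"
    and x: "x \<in> S" and xt: "x + t *\<^sub>R e \<in> S"
  shows "d * t \<le> f (x + t *\<^sub>R e) - f x"
proof -
  let ?A = "{t. x + t *\<^sub>R e \<in> S}"
  have line: "convex_on ?A (\<lambda>t. f (x + t *\<^sub>R e))" by (rule convex_on_line[OF conv])
  have "f (x + t *\<^sub>R e) - f (x + 0 *\<^sub>R e) \<ge> d * (t - 0)"
  proof (rule convex_on_imp_above_tangent[OF line])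
    show "connected ?A" using line by (simp add: convex_on_def convex_connected)
    show "0 \<in> interior ?A" using x open_line_preimage[OF \<open>open S\<close>] by (simp add: interior_open)
    show "((\<lambda>t. f (x + t *\<^sub>R e)) has_field_derivative d) (at 0 within ?A)"
      by (rule has_field_derivative_at_within[OF der])
  qed (use xt in auto)
  then show ?thesis by simp
qed

text \<open>
Upper semicontinuity of a directional derivative: by convexity it is bounded above by every forward
difference quotient, and for a fixed step these quotients are continuous in the base point.
\<close>

lemma convex_directional_derivative_eventually_less:
  fixes f :: "'a::euclidean_space \<Rightarrow> real"
  assumes "open S" and conv: "convex_on S f"
    and der: "\<And>x. x \<in> S \<Longrightarrow> ((\<lambda>t. f (x + t *\<^sub>R e)) has_real_derivative g x) (at 0)"
    and x: "x \<in> S" and less: "g x < b"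
  shows "\<forall>\<^sub>F y in at x. g y < b"
proof -
  have cont: "isCont f y" if "y \<in> S" for y
    using convex_on_continuous[OF \<open>open S\<close> conv] that continuous_on_eq_continuous_at[OF \<open>open S\<close>] by blast
  have "((\<lambda>t. (f (x + t *\<^sub>R e) - f x) / t) \<longlongrightarrow> g x) (at_right 0)"
    using der[OF x] unfolding DERIV_def by (auto intro: tendsto_within_subset)
  then have "\<forall>\<^sub>F t in at_right 0. (f (x + t *\<^sub>R e) - f x) / t < b"
    using less by (rule order_tendstoD)
  moreover have "\<forall>\<^sub>F t in at_right (0::real). t \<in> {t. x + t *\<^sub>R e \<in> S}"
    using eventually_nhds_in_open[OF open_line_preimage[OF \<open>open S\<close>], of 0 x e] x
    unfolding eventually_at_filter by (auto elim!: eventually_mono)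
  moreover have "\<forall>\<^sub>F t in at_right (0::real). 0 < t"
    by (rule eventually_at_right_less)
  ultimately have "\<forall>\<^sub>F t in at_right (0::real). (f (x + t *\<^sub>R e) - f x) / t < b \<and> x + t *\<^sub>R e \<in> S \<and> 0 < t"
    by eventually_elim simp
  then obtain t where t: "(f (x + t *\<^sub>R e) - f x) / t < b" "x + t *\<^sub>R e \<in> S" "0 < t"
    using eventually_happens[of _ "at_right (0::real)"] by auto
  have shift: "((\<lambda>y. y + t *\<^sub>R e) \<longlongrightarrow> x + t *\<^sub>R e) (at x)"
    by (intro tendsto_intros)
  have "((\<lambda>y. (f (y + t *\<^sub>R e) - f y) / t) \<longlongrightarrow> (f (x + t *\<^sub>R e) - f x) / t) (at x)"
    using t(3) isCont_tendsto_compose[OF cont[OF t(2)] shift] cont[OF x]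
    by (intro tendsto_intros) (auto simp: isCont_def)
  then have "\<forall>\<^sub>F y in at x. (f (y + t *\<^sub>R e) - f y) / t < b"
    using t(1) by (rule order_tendstoD)
  moreover have "\<forall>\<^sub>F y in at x. y + t *\<^sub>R e \<in> S"
    using shift \<open>open S\<close> t(2) by (rule topological_tendstoD)
  moreover have "\<forall>\<^sub>F y in at x. y \<in> S"
    using \<open>open S\<close> x by (rule eventually_at_in_open')
  ultimately show ?thesis
  proof eventually_elim
    case (elim y)
    have "g y * t \<le> f (y + t *\<^sub>R e) - f y"
      using convex_ge_directional_tangent[OF \<open>open S\<close> conv der[OF elim(3)] elim(3,2)] .
    then have "g y \<le> (f (y + t *\<^sub>R e) - f y) / t"
      using t(3) by (simp add: pos_le_divide_eq)
    then show ?case using elim(1) by linarith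
  qed
qed

text \<open>
The derivative in direction \<open>- e\<close> is the
negative of the one in direction \<open>e\<close>, so upper semicontinuity in both directions gives continuity.
\<close>

lemma convex_directional_derivative_continuous:
  fixes f :: "'a::euclidean_space \<Rightarrow> real"
  assumes "open S" and conv: "convex_on S f"
    and der: "\<And>x. x \<in> S \<Longrightarrow> ((\<lambda>t. f (x + t *\<^sub>R e)) has_real_derivative g x) (at 0)"
  shows "continuous_on S g"
  unfolding continuous_on_eq_continuous_at[OF \<open>open S\<close>] isCont_def
proof
  fix x assume x: "x \<in> S"
  have neg: "((\<lambda>t. f (y + t *\<^sub>R (- e))) has_real_derivative - g y) (at 0)" if "y \<in> S" for y
  proof -
    have "((\<lambda>t. f (y + t *\<^sub>R e)) has_real_derivative g y) (at (- 0))" using der[OF that] by simp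
    then show ?thesis unfolding DERIV_mirror by simp
  qed
  show "(g \<longlongrightarrow> g x) (at x)"
  proof (rule order_tendstoI)
    fix b assume "g x < b"
    then show "\<forall>\<^sub>F y in at x. g y < b"
      using convex_directional_derivative_eventually_less[OF \<open>open S\<close> conv der x] by blast
  next
    fix b assume "b < g x"
    then have "- g x < - b" by simp
    from convex_directional_derivative_eventually_less[OF \<open>open S\<close> conv neg x this]
    show "\<forall>\<^sub>F y in at x. b < g y" by simp
  qed
qed

lemma convex_second_directional_derivative_nonneg:
  fixes f :: "'a::real_normed_vector \<Rightarrow> real"
  assumes "open S" and conv: "convex_on S f"
    and der: "\<And>x. x \<in> S \<Longrightarrow> ((\<lambda>t. f (x + t *\<^sub>R e)) has_real_derivative g x) (at 0)"
    and x: "x \<in> S" and der2: "((\<lambda>t. g (x + t *\<^sub>R e)) has_real_derivative d) (at 0)"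
  shows "0 \<le> d"
proof (rule mono_on_imp_deriv_nonneg[OF _ der2])
  let ?A = "{t. x + t *\<^sub>R e \<in> S}"
  show "0 \<in> interior ?A" using x open_line_preimage[OF \<open>open S\<close>] by (simp add: interior_open)
  show "mono_on ?A (\<lambda>t. g (x + t *\<^sub>R e))"
  proof (rule mono_onI)
    fix r s assume rs: "r \<in> ?A" "s \<in> ?A" "r \<le> s"
    have "g (x + r *\<^sub>R e) * (s - r) \<le> f (x + s *\<^sub>R e) - f (x + r *\<^sub>R e)"
      using convex_ge_directional_tangent[OF \<open>open S\<close> conv der, of "x + r *\<^sub>R e" "s - r"] rs
      by (simp add: algebra_simps)
    moreover have "g (x + s *\<^sub>R e) * (r - s) \<le> f (x + r *\<^sub>R e) - f (x + s *\<^sub>R e)"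
      using convex_ge_directional_tangent[OF \<open>open S\<close> conv der, of "x + s *\<^sub>R e" "r - s"] rs
      by (simp add: algebra_simps)
    ultimately have "g (x + r *\<^sub>R e) * (s - r) \<le> g (x + s *\<^sub>R e) * (s - r)"
      by (simp add: algebra_simps)
    then show "g (x + r *\<^sub>R e) \<le> g (x + s *\<^sub>R e)"
      using rs(3) by (cases "r = s") auto
  qed
qed

section \<open>From the Laplace equation to holomorphy\<close>

lemma has_vector_derivative_at_shift:
  assumes "((\<lambda>r. g (t + r)) has_vector_derivative D) (at 0)"
  shows "(g has_vector_derivative D) (at t)"
proof -
  have "((\<lambda>r. r - t) has_vector_derivative 1) (at t)"
    by (auto intro!: derivative_eq_intros)
  from vector_diff_chain_at[OF this, of "\<lambda>r. g (t + r)" D] assms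
  show ?thesis by (simp add: o_def)
qed

lemma has_real_derivative_at_shift:
  fixes g :: "real \<Rightarrow> real"
  assumes "((\<lambda>r. g (t + r)) has_real_derivative D) (at 0)"
  shows "(g has_real_derivative D) (at t)"
  using assms DERIV_shift[of g D 0 t] by (simp add: add.commute)

text \<open>
The increment from \<open>z\<close> to a nearby point is split into a horizontal and a vertical step. Along each
step the mean value inequality compares the increment of \<open>\<Phi>\<close> with that of the linear map given by
\<open>f z\<close>, and the error is controlled by the oscillation of the continuous function \<open>f\<close>.
\<close>

lemma has_field_derivative_of_axis_derivatives:
  fixes \<Phi> f :: "complex \<Rightarrow> complex"
  assumes "open S" and cont: "continuous_on S f" and "z \<in> S"
    and hor: "\<And>z. z \<in> S \<Longrightarrow> ((\<lambda>t. \<Phi> (z + t *\<^sub>R 1)) has_vector_derivative f z) (at 0)"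
    and ver: "\<And>z. z \<in> S \<Longrightarrow> ((\<lambda>t. \<Phi> (z + t *\<^sub>R \<i>)) has_vector_derivative \<i> * f z) (at 0)"
  shows "(\<Phi> has_field_derivative f z) (at z)"
  unfolding has_field_derivative_def has_derivative_at_alt
proof (intro conjI allI impI)
  show "bounded_linear ((*) (f z))"
    by (rule bounded_linear_mult_right)
next
  fix e :: real assume "e > 0"
  obtain d1 where d1: "d1 > 0" "ball z d1 \<subseteq> S"
    using \<open>open S\<close> \<open>z \<in> S\<close> by (meson open_contains_ball)
  obtain d2 where d2: "d2 > 0" "\<And>w. w \<in> S \<Longrightarrow> dist w z < d2 \<Longrightarrow> dist (f w) (f z) < e/2"
    using cont[unfolded continuous_on_iff, rule_format, OF \<open>z \<in> S\<close>, of "e/2"] \<open>e > 0\<close> by auto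
  define d where "d = min d1 d2"
  have line: "norm (\<Phi> (w + s *\<^sub>R v) - \<Phi> w - s *\<^sub>R (v * f z)) \<le> \<bar>s\<bar> * (e/2)"
    if vv: "v = 1 \<or> v = \<i>" and seg: "\<And>t. t \<in> closed_segment 0 s \<Longrightarrow> norm (w + t *\<^sub>R v - z) < d" for w v s
  proof -
    have inS: "w + t *\<^sub>R v \<in> S" and close: "norm (f (w + t *\<^sub>R v) - f z) \<le> e/2"
      if "t \<in> closed_segment 0 s" for t
    proof -
      have "w + t *\<^sub>R v \<in> ball z d1"
        using seg[OF that] by (simp add: d_def dist_norm norm_minus_commute)
      then show "w + t *\<^sub>R v \<in> S" using d1 by auto
      then show "norm (f (w + t *\<^sub>R v) - f z) \<le> e/2"
        using d2(2)[of "w + t *\<^sub>R v"] seg[OF that] by (simp add: d_def dist_norm)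
    qed
    define g where "g t = \<Phi> (w + t *\<^sub>R v) - t *\<^sub>R (v * f z)" for t
    have der: "(g has_vector_derivative v * f (w + t *\<^sub>R v) - v * f z) (at t within closed_segment 0 s)"
      if t: "t \<in> closed_segment 0 s" for t
    proof -
      have "((\<lambda>r. \<Phi> (w + t *\<^sub>R v + r *\<^sub>R v)) has_vector_derivative v * f (w + t *\<^sub>R v)) (at 0)"
        using vv hor[OF inS[OF t]] ver[OF inS[OF t]] by auto
      then have "((\<lambda>r. \<Phi> (w + r *\<^sub>R v)) has_vector_derivative v * f (w + t *\<^sub>R v)) (at t)"
        by - (rule has_vector_derivative_at_shift, simp add: scaleR_add_left add.assoc)
      then have "((\<lambda>r. \<Phi> (w + r *\<^sub>R v)) has_vector_derivative v * f (w + t *\<^sub>R v)) (at t within closed_segment 0 s)"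
        by (rule has_vector_derivative_at_within)
      then show ?thesis unfolding g_def
        by (auto intro!: derivative_eq_intros)
    qed
    have "norm (g s - g 0) \<le> e/2 * norm (s - 0)"
    proof (rule differentiable_bound[where S="closed_segment 0 s" and f'="\<lambda>t h. h *\<^sub>R (v * f (w + t *\<^sub>R v) - v * f z)"])
      show "onorm (\<lambda>h. h *\<^sub>R (v * f (w + t *\<^sub>R v) - v * f z)) \<le> e/2" if "t \<in> closed_segment 0 s" for t
      proof (rule onorm_le)
        fix h :: real
        have "norm (v * f (w + t *\<^sub>R v) - v * f z) = norm (f (w + t *\<^sub>R v) - f z)"
          using vv by (auto simp: norm_mult right_diff_distrib[symmetric])
        then show "norm (h *\<^sub>R (v * f (w + t *\<^sub>R v) - v * f z)) \<le> e/2 * norm h"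
          using mult_right_mono[OF close[OF that], of "norm h"] by (simp add: mult.commute)
      qed
    qed (use der in \<open>auto simp: has_vector_derivative_def\<close>)
    then show ?thesis by (simp add: g_def algebra_simps)
  qed
  show "\<exists>d>0. \<forall>y. norm (y - z) < d \<longrightarrow> norm (\<Phi> y - \<Phi> z - f z * (y - z)) \<le> e * norm (y - z)"
  proof (intro exI conjI allI impI)
    show "d > 0" using d1 d2 by (simp add: d_def)
    fix y assume y: "norm (y - z) < d"
    define p q where "p = Re (y - z)" and "q = Im (y - z)"
    have pq: "y = z + p *\<^sub>R 1 + q *\<^sub>R \<i>" by (simp add: p_def q_def complex_eq_iff)
    have le: "\<bar>p\<bar> \<le> norm (y - z)" "\<bar>q\<bar> \<le> norm (y - z)"
      unfolding p_def q_def by (rule abs_Re_le_cmod abs_Im_le_cmod)+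
    have "norm (\<Phi> (z + p *\<^sub>R 1) - \<Phi> z - p *\<^sub>R (1 * f z)) \<le> \<bar>p\<bar> * (e/2)"
    proof (rule line)
      fix t assume "t \<in> closed_segment 0 p"
      then have "\<bar>t\<bar> \<le> \<bar>p\<bar>" by (auto simp: closed_segment_eq_real_ivl split: if_splits)
      then show "norm (z + t *\<^sub>R 1 - z) < d" using le y by simp
    qed simp
    moreover have "norm (\<Phi> (z + p *\<^sub>R 1 + q *\<^sub>R \<i>) - \<Phi> (z + p *\<^sub>R 1) - q *\<^sub>R (\<i> * f z)) \<le> \<bar>q\<bar> * (e/2)"
    proof (rule line)
      fix t assume "t \<in> closed_segment 0 q"
      then have "\<bar>t\<bar> \<le> \<bar>q\<bar>" by (auto simp: closed_segment_eq_real_ivl split: if_splits)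
      then have "t\<^sup>2 \<le> q\<^sup>2" by (simp add: abs_le_square_iff)
      then have "norm (z + p *\<^sub>R 1 + t *\<^sub>R \<i> - z) \<le> norm (y - z)"
        by (simp add: cmod_def pq)
      then show "norm (z + p *\<^sub>R 1 + t *\<^sub>R \<i> - z) < d" using y by simp
    qed simp
    moreover have "\<Phi> y - \<Phi> z - f z * (y - z) = (\<Phi> (z + p *\<^sub>R 1) - \<Phi> z - p *\<^sub>R (1 * f z))
         + (\<Phi> (z + p *\<^sub>R 1 + q *\<^sub>R \<i>) - \<Phi> (z + p *\<^sub>R 1) - q *\<^sub>R (\<i> * f z))"
      unfolding pq by (simp add: algebra_simps)
    ultimately have "norm (\<Phi> y - \<Phi> z - f z * (y - z)) \<le> \<bar>p\<bar> * (e/2) + \<bar>q\<bar> * (e/2)"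
      by (simp only: norm_triangle_mono)
    also have "\<dots> \<le> norm (y - z) * (e/2) + norm (y - z) * (e/2)"
      using le \<open>e > 0\<close> by (intro add_mono mult_right_mono) auto
    finally show "norm (\<Phi> y - \<Phi> z - f z * (y - z)) \<le> e * norm (y - z)"
      by (simp add: algebra_simps)
  qed
qed

text \<open>
By the mean value inequality, the bound \<open>C\<close> on \<open>A\<close> is also one on all difference quotients of \<open>p\<close>.
Dominated convergence along an arbitrary sequence of increments then takes the place that uniform
convergence has in the version for a continuous derivative.
\<close>

lemma leibniz_rule_bounded_derivative:
  fixes p A :: "real \<Rightarrow> real \<Rightarrow> real"
  assumes x: "x \<in> {l<..<r}"
    and der: "\<And>x s. x \<in> {l<..<r} \<Longrightarrow> s \<in> {c..d} \<Longrightarrow> ((\<lambda>x. p x s) has_real_derivative A x s) (at x)"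
    and bd: "\<And>x s. x \<in> {l<..<r} \<Longrightarrow> s \<in> {c..d} \<Longrightarrow> \<bar>A x s\<bar> \<le> C"
    and int: "\<And>x. x \<in> {l<..<r} \<Longrightarrow> p x integrable_on {c..d}"
  shows "((\<lambda>x. integral {c..d} (p x)) has_real_derivative integral {c..d} (A x)) (at x)"
  unfolding DERIV_def tendsto_at_iff_sequentially comp_def
proof (intro allI impI)
  fix X :: "nat \<Rightarrow> real"
  assume Xne: "\<forall>i. X i \<in> UNIV - {0}" and X0: "X \<longlonglongrightarrow> 0"
  have "(\<lambda>i. x + X i) \<longlonglongrightarrow> x + 0"
    using X0 by (intro tendsto_add tendsto_const)
  then have "\<forall>\<^sub>F i in sequentially. x + X i \<in> {l<..<r}"
    by (rule topological_tendstoD) (use x in auto)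
  then obtain N where N: "\<And>i. i \<ge> N \<Longrightarrow> x + X i \<in> {l<..<r}"
    by (auto simp: eventually_sequentially)
  define Y where "Y i = X (i + N)" for i
  have Y: "x + Y i \<in> {l<..<r}" "Y i \<noteq> 0" for i
    using N[of "i + N"] Xne by (auto simp: Y_def)
  have Y0: "Y \<longlonglongrightarrow> 0"
    unfolding Y_def using X0 by (rule LIMSEQ_ignore_initial_segment)
  have quot: "norm ((p (x + Y i) s - p x s) / Y i) \<le> C" if s: "s \<in> {c..d}" for i s
  proof -
    have "norm (p (x + Y i) s - p x s) \<le> C * norm (x + Y i - x)"
    proof (rule field_differentiable_bound[of "{l<..<r}"])
      fix y assume "y \<in> {l<..<r}"
      then show "((\<lambda>x. p x s) has_field_derivative A y s) (at y within {l<..<r})"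
        using der s by (auto intro: has_field_derivative_at_within)
    qed (use x Y bd s in auto)
    then show ?thesis
      using Y(2)[of i] by (simp add: divide_le_eq)
  qed
  have "(\<lambda>i. integral {c..d} (\<lambda>s. (p (x + Y i) s - p x s) / Y i)) \<longlonglongrightarrow> integral {c..d} (A x)"
  proof (rule dominated_convergence)
    show "(\<lambda>s. (p (x + Y i) s - p x s) / Y i) integrable_on {c..d}" for i
      using x Y by (intro integrable_on_divide integrable_diff int)
    show "(\<lambda>i. (p (x + Y i) s - p x s) / Y i) \<longlonglongrightarrow> A x s" if "s \<in> {c..d}" for s
      using der[OF x that] Y Y0
      unfolding DERIV_def tendsto_at_iff_sequentially comp_def by auto
    show "(\<lambda>s. C) integrable_on {c..d}" by (rule integrable_const_ivl)
  qed (use quot in auto)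
  moreover have "integral {c..d} (\<lambda>s. (p (x + Y i) s - p x s) / Y i)
      = (integral {c..d} (p (x + Y i)) - integral {c..d} (p x)) / Y i" for i
    using x Y by (simp add: integral_diff int)
  ultimately have "(\<lambda>i. (integral {c..d} (p (x + Y i)) - integral {c..d} (p x)) / Y i)
      \<longlonglongrightarrow> integral {c..d} (A x)"
    by (simp only:)
  then show "(\<lambda>i. (integral {c..d} (p (x + X i)) - integral {c..d} (p x)) / X i)
      \<longlonglongrightarrow> integral {c..d} (A x)"
    unfolding Y_def by (rule LIMSEQ_offset)
qed

text \<open>
Near each point a harmonic conjugate \<open>K\<close> of \<open>h\<close> is defined by integrating the conjugate
differential \<open>- Q dx + P dy\<close> along an L-shaped path from a corner of a rectangle. The vertical derivative
of \<open>K\<close> is \<open>P\<close> by the fundamental theorem of calculus. For the horizontal derivative, the Leibniz rule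
turns the integral of \<open>P\<close> into one of \<open>A = - B\<close>, and \<open>B\<close> integrates back to \<open>Q\<close>. Thus \<open>h + \<i> K\<close> is a
primitive of \<open>P - \<i> Q\<close>, and derivatives of holomorphic functions are holomorphic.
\<close>

lemma harmonic_imp_holomorphic_gradient:
  fixes h P Q A B :: "complex \<Rightarrow> real"
  assumes "open D"
    and P: "\<And>z. z \<in> D \<Longrightarrow> ((\<lambda>t. h (z + t *\<^sub>R 1)) has_real_derivative P z) (at 0)"
    and Q: "\<And>z. z \<in> D \<Longrightarrow> ((\<lambda>t. h (z + t *\<^sub>R \<i>)) has_real_derivative Q z) (at 0)"
    and A: "\<And>z. z \<in> D \<Longrightarrow> ((\<lambda>t. P (z + t *\<^sub>R 1)) has_real_derivative A z) (at 0)"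
    and B: "\<And>z. z \<in> D \<Longrightarrow> ((\<lambda>t. Q (z + t *\<^sub>R \<i>)) has_real_derivative B z) (at 0)"
    and harmonic: "\<And>z. z \<in> D \<Longrightarrow> A z + B z = 0"
    and bound: "\<And>z. z \<in> D \<Longrightarrow> \<bar>A z\<bar> \<le> C"
    and contP: "continuous_on D P" and contQ: "continuous_on D Q"
  shows "(\<lambda>z. Complex (P z) (- Q z)) holomorphic_on D"
  unfolding holomorphic_on_def
proof
  fix z0 assume "z0 \<in> D"
  obtain \<alpha> \<beta> where box: "cbox \<alpha> \<beta> \<subseteq> D" "z0 \<in> box \<alpha> \<beta>"
    using open_contains_cbox[OF \<open>open D\<close> \<open>z0 \<in> D\<close>] by metis
  define f where "f z = Complex (P z) (- Q z)" for z
  define K where "K z = integral {Im \<alpha>..Im z} (\<lambda>s. P (Complex (Re z) s))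
                      - integral {Re \<alpha>..Re z} (\<lambda>s. Q (Complex s (Im \<alpha>)))" for z
  define \<Phi> where "\<Phi> z = Complex (h z) (K z)" for z
  have inD: "Complex x y \<in> D" if "x \<in> {Re \<alpha>..Re \<beta>}" "y \<in> {Im \<alpha>..Im \<beta>}" for x y
    using that box(1) by (auto simp: in_cbox_complex_iff)
  have contf: "continuous_on D f"
    unfolding f_def using contP contQ
    by (auto simp: Complex_eq intro!: continuous_intros)
  have contP': "continuous_on {Im \<alpha>..Im \<beta>} (\<lambda>s. P (Complex x s))" if "x \<in> {Re \<alpha>..Re \<beta>}" for x
    by (rule continuous_on_compose2[OF contP])
       (use that inD in \<open>auto simp: Complex_eq intro!: continuous_intros\<close>)
  have contQ': "continuous_on {Re \<alpha>..Re \<beta>} (\<lambda>s. Q (Complex s (Im \<alpha>)))"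
  proof -
    have "Im \<alpha> \<le> Im \<beta>" using box(2) by (auto simp: in_box_complex_iff)
    then show ?thesis
      by (intro continuous_on_compose2[OF contQ])
         (use inD in \<open>auto simp: Complex_eq intro!: continuous_intros\<close>)
  qed
  have Kver: "((\<lambda>t. K (z + t *\<^sub>R \<i>)) has_real_derivative P z) (at 0)" if z: "z \<in> box \<alpha> \<beta>" for z
  proof -
    have "((\<lambda>y. integral {Im \<alpha>..y} (\<lambda>s. P (Complex (Re z) s))) has_real_derivative P (Complex (Re z) (Im z)))
            (at (Im z) within {Im \<alpha>..Im \<beta>})"
      using z by (intro integral_has_real_derivative contP') (auto simp: in_box_complex_iff)
    then have "((\<lambda>y. integral {Im \<alpha>..y} (\<lambda>s. P (Complex (Re z) s))) has_real_derivative P z) (at (Im z))"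
      using z by (subst (asm) at_within_interior) (auto simp: in_box_complex_iff)
    then have "((\<lambda>y. integral {Im \<alpha>..Im z + y} (\<lambda>s. P (Complex (Re z) s))) has_real_derivative P z) (at 0)"
      using DERIV_shift[of "\<lambda>y. integral {Im \<alpha>..y} (\<lambda>s. P (Complex (Re z) s))" "P z" 0 "Im z"]
      by (simp add: add.commute)
    then show ?thesis
      unfolding K_def by (auto intro!: derivative_eq_intros)
  qed
  have Khor: "((\<lambda>t. K (z + t *\<^sub>R 1)) has_real_derivative - Q z) (at 0)" if z: "z \<in> box \<alpha> \<beta>" for z
  proof -
    have zr: "Re z \<in> {Re \<alpha><..<Re \<beta>}" and zi: "Im z \<in> {Im \<alpha><..<Im \<beta>}"
      using z by (auto simp: in_box_complex_iff)
    have "((\<lambda>x. integral {Im \<alpha>..Im z} (\<lambda>s. P (Complex x s))) has_real_derivative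
            integral {Im \<alpha>..Im z} (\<lambda>s. A (Complex (Re z) s))) (at (Re z))"
    proof (rule leibniz_rule_bounded_derivative[OF zr])
      fix x s assume x: "x \<in> {Re \<alpha><..<Re \<beta>}" and s: "s \<in> {Im \<alpha>..Im z}"
      then have D: "Complex x s \<in> D" using zi by (intro inD) auto
      show "((\<lambda>x. P (Complex x s)) has_real_derivative A (Complex x s)) (at x)"
        using A[OF D] by - (rule has_real_derivative_at_shift, simp add: plus_complex.code)
      show "\<bar>A (Complex x s)\<bar> \<le> C" using bound D by blast
    next
      fix x assume "x \<in> {Re \<alpha><..<Re \<beta>}"
      then show "(\<lambda>s. P (Complex x s)) integrable_on {Im \<alpha>..Im z}"
        using zi by (intro integrable_continuous_interval continuous_on_subset[OF contP']) auto
    qed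
    moreover have "((\<lambda>s. B (Complex (Re z) s)) has_integral Q (Complex (Re z) (Im z)) - Q (Complex (Re z) (Im \<alpha>))) {Im \<alpha>..Im z}"
    proof (rule fundamental_theorem_of_calculus)
      fix s assume "s \<in> {Im \<alpha>..Im z}"
      then have D: "Complex (Re z) s \<in> D" using zi zr by (intro inD) auto
      have "((\<lambda>s. Q (Complex (Re z) s)) has_real_derivative B (Complex (Re z) s)) (at s)"
        using B[OF D] by - (rule has_real_derivative_at_shift, simp add: plus_complex.code)
      then show "((\<lambda>s. Q (Complex (Re z) s)) has_vector_derivative B (Complex (Re z) s)) (at s within {Im \<alpha>..Im z})"
        by (simp add: has_real_derivative_iff_has_vector_derivative has_vector_derivative_at_within)
    qed (use zi in auto)
    moreover have "integral {Im \<alpha>..Im z} (\<lambda>s. A (Complex (Re z) s))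
        = integral {Im \<alpha>..Im z} (\<lambda>s. - B (Complex (Re z) s))"
    proof (rule integral_cong)
      fix s assume "s \<in> {Im \<alpha>..Im z}"
      then have D: "Complex (Re z) s \<in> D" using zi zr by (intro inD) auto
      show "A (Complex (Re z) s) = - B (Complex (Re z) s)" using harmonic[OF D] by simp
    qed
    ultimately have 1: "((\<lambda>x. integral {Im \<alpha>..Im z} (\<lambda>s. P (Complex x s))) has_real_derivative
            Q (Complex (Re z) (Im \<alpha>)) - Q z) (at (Re z))"
      by (simp add: integral_unique)
    have "((\<lambda>x. integral {Re \<alpha>..x} (\<lambda>s. Q (Complex s (Im \<alpha>)))) has_real_derivative Q (Complex (Re z) (Im \<alpha>)))
            (at (Re z) within {Re \<alpha>..Re \<beta>})"
      using zr by (intro integral_has_real_derivative contQ') auto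
    then have 2: "((\<lambda>x. integral {Re \<alpha>..x} (\<lambda>s. Q (Complex s (Im \<alpha>)))) has_real_derivative Q (Complex (Re z) (Im \<alpha>)))
            (at (Re z))"
      using zr by (subst (asm) at_within_interior) auto
    have "((\<lambda>x. integral {Im \<alpha>..Im z} (\<lambda>s. P (Complex x s))
               - integral {Re \<alpha>..x} (\<lambda>s. Q (Complex s (Im \<alpha>)))) has_real_derivative - Q z) (at (0 + Re z))"
      using DERIV_diff[OF 1 2] by simp
    then show ?thesis
      unfolding K_def DERIV_shift by (simp add: add.commute)
  qed
  have axis: "((\<lambda>t. \<Phi> (z + t *\<^sub>R v)) has_vector_derivative Complex p k) (at 0)"
    if "((\<lambda>t. h (z + t *\<^sub>R v)) has_real_derivative p) (at 0)"
       "((\<lambda>t. K (z + t *\<^sub>R v)) has_real_derivative k) (at 0)" for z v p k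
    using that unfolding \<Phi>_def
    by (auto simp: has_real_derivative_iff_has_vector_derivative has_vector_derivative_complex_iff)
  have \<Phi>: "(\<Phi> has_field_derivative f z) (at z)" if "z \<in> box \<alpha> \<beta>" for z
  proof (rule has_field_derivative_of_axis_derivatives[OF open_box _ that])
    fix z assume z: "z \<in> box \<alpha> \<beta>"
    then have D: "z \<in> D" using box(1) box_subset_cbox by blast
    show "((\<lambda>t. \<Phi> (z + t *\<^sub>R 1)) has_vector_derivative f z) (at 0)"
      unfolding f_def by (intro axis P[OF D] Khor[OF z])
    have "\<i> * f z = Complex (Q z) (P z)" by (simp add: f_def complex_eq_iff)
    then show "((\<lambda>t. \<Phi> (z + t *\<^sub>R \<i>)) has_vector_derivative \<i> * f z) (at 0)"
      using axis[OF Q[OF D] Kver[OF z]] by simp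
  qed (use contf box(1) box_subset_cbox continuous_on_subset in blast)
  have "\<Phi> holomorphic_on box \<alpha> \<beta>"
    using \<Phi> by (auto simp: holomorphic_on_open open_box)
  then have "deriv \<Phi> holomorphic_on box \<alpha> \<beta>"
    by (rule holomorphic_deriv) (rule open_box)
  then have "f holomorphic_on box \<alpha> \<beta>"
    by (rule holomorphic_transform) (use \<Phi> DERIV_imp_deriv in blast)
  then have "f field_differentiable (at z0)"
    using box(2) open_box holomorphic_on_imp_differentiable_at by blast
  then show "(\<lambda>z. Complex (P z) (- Q z)) field_differentiable (at z0 within D)"
    unfolding f_def by (rule field_differentiable_at_within)
qed

section \<open>Uniqueness for the Cauchy problem on a line\<close>

text \<open>
Extended by 0 beyond the line, \<open>g\<close> becomes a continuous function on \<open>S\<close> that is holomorphic on both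
sides of the line, hence holomorphic on all of \<open>S\<close>. It vanishes on a nonempty open set, so the identity
theorem applies.
\<close>

lemma holomorphic_zero_of_zero_boundary_values_on_line:
  fixes d :: complex
  assumes "open S" and "connected S" and "d \<noteq> 0"
    and hol: "g holomorphic_on S \<inter> {z. k < d \<bullet> z}"
    and lim: "\<And>z. z \<in> S \<Longrightarrow> d \<bullet> z = k \<Longrightarrow> (g \<longlongrightarrow> 0) (at z within S \<inter> {z. k < d \<bullet> z})"
    and below: "S \<inter> {z. d \<bullet> z < k} \<noteq> {}"
    and z: "z \<in> S \<inter> {z. k < d \<bullet> z}"
  shows "g z = 0"
proof -
  define f where "f z = (if k < d \<bullet> z then g z else 0)" for z
  let ?D = "S \<inter> {z. k < d \<bullet> z}"
  have "open {z. k < d \<bullet> z}" "open {z. d \<bullet> z < k}"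
    by (intro open_Collect_less continuous_intros)+
  then have openD: "open ?D" and openB: "open (S \<inter> {z. d \<bullet> z < k})"
    using \<open>open S\<close> by auto
  have holf: "f holomorphic_on ?D"
    by (rule holomorphic_transform[OF hol]) (auto simp: f_def)
  have contf: "continuous_on S f"
    unfolding continuous_on_def
  proof
    fix w assume w: "w \<in> S"
    consider "k < d \<bullet> w" | "d \<bullet> w < k" | "d \<bullet> w = k" by linarith
    then show "(f \<longlongrightarrow> f w) (at w within S)"
    proof cases
      case 1
      then have "isCont f w"
        using holomorphic_on_imp_continuous_on[OF holf] openD w continuous_on_eq_continuous_at by blast
      then show ?thesis by (auto simp: isCont_def intro: tendsto_within_subset)
    next
      case 2
      then have "\<forall>\<^sub>F v in nhds w. v \<in> S \<inter> {z. d \<bullet> z < k}"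
        using openB w by (intro eventually_nhds_in_open) auto
      then have "\<forall>\<^sub>F v in at w within S. f v = 0"
        by (auto simp: f_def eventually_at_filter elim!: eventually_mono)
      then show ?thesis using 2 by (simp add: f_def tendsto_eventually)
    next
      case 3
      have "(S - {w}) \<inter> {z. k < d \<bullet> z} = ?D - {w}" by blast
      then have "at w within ?D = inf (at w within S) (principal {z. k < d \<bullet> z})"
        by (simp add: at_within_def inf_assoc)
      with lim[OF w 3] have "(g \<longlongrightarrow> 0) (inf (at w within S) (principal {z. k < d \<bullet> z}))"
        by simp
      then have "(f \<longlongrightarrow> 0) (at w within S)"
        unfolding f_def by (rule filterlim_If) simp
      then show ?thesis using 3 by (simp add: f_def)
    qed
  qed
  have "f holomorphic_on S"
  proof (rule holomorphic_on_paste_across_line[OF \<open>open S\<close> \<open>d \<noteq> 0\<close> _ holf contf])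
    show "f holomorphic_on S \<inter> {z. d \<bullet> z < k}"
      by (rule holomorphic_transform[of "\<lambda>_. 0"]) (auto simp: f_def)
  qed
  have "f z = (\<lambda>_. 0) z"
  proof (rule analytic_continuation_open[OF openB \<open>open S\<close> below \<open>connected S\<close> _ \<open>f holomorphic_on S\<close>])
    show "z \<in> S" using z by simp
    show "f w = 0" if "w \<in> S \<inter> {z. d \<bullet> z < k}" for w
      using that by (simp add: f_def)
  qed auto
  then show ?thesis using z by (simp add: f_def)
qed

section \<open>Boundary gradients and normals\<close>

lemma GDERIV_along_line:
  assumes "GDERIV h (w + t *\<^sub>R v) :> G"
  shows "((\<lambda>t. h (w + t *\<^sub>R v)) has_real_derivative G \<bullet> v) (at t)"
proof -
  have "((\<lambda>t. w + t *\<^sub>R v) has_derivative (\<lambda>s. s *\<^sub>R v)) (at t)"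
    by (auto intro!: derivative_eq_intros)
  from has_derivative_compose[OF this assms[unfolded gderiv_def]]
  show ?thesis by (simp add: has_field_derivative_def mult.commute[of _ "G \<bullet> v"] inner_commute)
qed

text \<open>
The boundary values of \<open>h\<close> along the segment from \<open>x\<close> in direction \<open>\<tau>\<close> are constant, but they are only
limits from inside \<open>D\<close>, as is the gradient \<open>p\<close>. So the segment is pushed into \<open>D\<close> by \<open>r *\<^sub>R \<nu>\<close>. On the
shifted segment the increment of \<open>h\<close> is close to
\<open>s * (p \<bullet> \<tau>)\<close> by the mean value theorem, but it tends to 0 as the shift does.
\<close>

lemma boundary_gradient_tangential_zero:
  fixes h :: "'a::real_inner \<Rightarrow> real"
  assumes G: "\<And>y. y \<in> D \<Longrightarrow> GDERIV h y :> G y" and lim: "(G \<longlongrightarrow> p) (at x within D)"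
    and "x \<notin> D" and "0 < \<delta>"
    and inner: "\<And>s r. 0 \<le> s \<Longrightarrow> s < \<delta> \<Longrightarrow> 0 < r \<Longrightarrow> r < \<delta> \<Longrightarrow> x + s *\<^sub>R \<tau> + r *\<^sub>R \<nu> \<in> D"
    and zero: "\<And>s. 0 \<le> s \<Longrightarrow> s < \<delta> \<Longrightarrow> (h \<longlongrightarrow> 0) (at (x + s *\<^sub>R \<tau>) within D)"
    and \<nu>: "\<nu> \<noteq> 0"
  shows "p \<bullet> \<tau> = 0"
proof (rule ccontr)
  define c where "c = p \<bullet> \<tau>"
  assume "p \<bullet> \<tau> \<noteq> 0"
  then have c: "\<bar>c\<bar> > 0" by (simp add: c_def)
  have "((\<lambda>y. G y \<bullet> \<tau>) \<longlongrightarrow> c) (at x within D)"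
    unfolding c_def by (intro tendsto_intros lim)
  from tendstoD[OF this half_gt_zero[OF c]]
  obtain \<eta> where \<eta>: "\<eta> > 0" "\<And>y. y \<in> D \<Longrightarrow> y \<noteq> x \<Longrightarrow> dist y x < \<eta> \<Longrightarrow> \<bar>G y \<bullet> \<tau> - c\<bar> < \<bar>c\<bar> / 2"
    unfolding eventually_at dist_real_def by blast
  \<comment> \<open>Steps of size below \<open>\<mu>\<close> in both directions stay within distance \<open>\<eta>\<close> of \<open>x\<close>.\<close>
  define \<mu> where "\<mu> = min \<delta> (\<eta> / (norm \<tau> + norm \<nu> + 1))"
  have den: "norm \<tau> + norm \<nu> + 1 > 0" by (smt (verit) norm_ge_zero)
  have \<mu>: "\<mu> > 0" using \<open>0 < \<delta>\<close> \<eta>(1) den by (simp add: \<mu>_def)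
  define s where "s = \<mu> / 2"
  have s: "0 < s" "s < \<mu>" using \<mu> by (auto simp: s_def)
  have "s < \<delta>" using s(2) by (simp add: \<mu>_def)
  have near: "x + q *\<^sub>R \<tau> + r *\<^sub>R \<nu> \<in> D \<and> dist (x + q *\<^sub>R \<tau> + r *\<^sub>R \<nu>) x < \<eta>"
    if "0 \<le> q" "q \<le> s" "0 < r" "r < \<mu>" for q r
  proof
    show "x + q *\<^sub>R \<tau> + r *\<^sub>R \<nu> \<in> D"
      using that s by (intro inner) (auto simp: \<mu>_def)
    have "norm (q *\<^sub>R \<tau> + r *\<^sub>R \<nu>) \<le> q * norm \<tau> + r * norm \<nu>"
      using norm_triangle_ineq[of "q *\<^sub>R \<tau>" "r *\<^sub>R \<nu>"] that by simp
    also have "\<dots> \<le> \<mu> * norm \<tau> + \<mu> * norm \<nu>"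
      using that s by (intro add_mono mult_right_mono) auto
    also have "\<dots> < \<mu> * (norm \<tau> + norm \<nu> + 1)"
      using \<mu> by (simp add: algebra_simps)
    also have "\<dots> \<le> \<eta>"
      using den by (simp add: \<mu>_def pos_le_divide_eq[symmetric])
    finally show "dist (x + q *\<^sub>R \<tau> + r *\<^sub>R \<nu>) x < \<eta>"
      by (simp add: dist_norm add.assoc)
  qed
  have est: "\<bar>h (x + s *\<^sub>R \<tau> + r *\<^sub>R \<nu>) - h (x + 0 *\<^sub>R \<tau> + r *\<^sub>R \<nu>) - s * c\<bar> \<le> s * (\<bar>c\<bar> / 2)"
    if r: "0 < r" "r < \<mu>" for r
  proof -
    have "\<exists>q>0. q < s \<and> h (x + r *\<^sub>R \<nu> + s *\<^sub>R \<tau>) - h (x + r *\<^sub>R \<nu> + 0 *\<^sub>R \<tau>)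
        = (s - 0) * (G (x + r *\<^sub>R \<nu> + q *\<^sub>R \<tau>) \<bullet> \<tau>)"
    proof (rule MVT2[OF s(1)])
      fix q assume "0 \<le> q" "q \<le> s"
      then have "x + r *\<^sub>R \<nu> + q *\<^sub>R \<tau> \<in> D"
        using near[of q r] r by (simp add: algebra_simps)
      then show "((\<lambda>q. h (x + r *\<^sub>R \<nu> + q *\<^sub>R \<tau>)) has_real_derivative G (x + r *\<^sub>R \<nu> + q *\<^sub>R \<tau>) \<bullet> \<tau>) (at q)"
        by (intro GDERIV_along_line G)
    qed
    then obtain q where q: "0 < q" "q < s"
      and eq: "h (x + s *\<^sub>R \<tau> + r *\<^sub>R \<nu>) - h (x + 0 *\<^sub>R \<tau> + r *\<^sub>R \<nu>)
        = s * (G (x + q *\<^sub>R \<tau> + r *\<^sub>R \<nu>) \<bullet> \<tau>)"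
      by (auto simp: algebra_simps)
    have "\<bar>G (x + q *\<^sub>R \<tau> + r *\<^sub>R \<nu>) \<bullet> \<tau> - c\<bar> \<le> \<bar>c\<bar> / 2"
      using \<eta>(2)[of "x + q *\<^sub>R \<tau> + r *\<^sub>R \<nu>"] near[of q r] q r \<open>x \<notin> D\<close>
      by (metis less_imp_le)
    then have "s * \<bar>G (x + q *\<^sub>R \<tau> + r *\<^sub>R \<nu>) \<bullet> \<tau> - c\<bar> \<le> s * (\<bar>c\<bar> / 2)"
      using s(1) by (intro mult_left_mono) auto
    then show ?thesis
      unfolding eq right_diff_distrib[symmetric] abs_mult using s(1) by simp
  qed
  have lim0: "((\<lambda>r. h (x + q *\<^sub>R \<tau> + r *\<^sub>R \<nu>)) \<longlongrightarrow> 0) (at_right 0)" if q: "0 \<le> q" "q < \<delta>" for q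
  proof (rule filterlim_compose[OF zero[OF q]])
    have "\<forall>\<^sub>F r in at_right 0. 0 < r \<and> r < \<delta>"
      using \<open>0 < \<delta>\<close> by (auto simp: eventually_at_right_field)
    then have "\<forall>\<^sub>F r in at_right 0. x + q *\<^sub>R \<tau> + r *\<^sub>R \<nu> \<in> D \<and> x + q *\<^sub>R \<tau> + r *\<^sub>R \<nu> \<noteq> x + q *\<^sub>R \<tau>"
      by eventually_elim (use inner q \<nu> in auto)
    moreover have "((\<lambda>r. x + q *\<^sub>R \<tau> + r *\<^sub>R \<nu>) \<longlongrightarrow> x + q *\<^sub>R \<tau> + 0 *\<^sub>R \<nu>) (at_right 0)"
      by (intro tendsto_intros)
    ultimately show "filterlim (\<lambda>r. x + q *\<^sub>R \<tau> + r *\<^sub>R \<nu>) (at (x + q *\<^sub>R \<tau>) within D) (at_right 0)"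
      by (simp add: filterlim_at)
  qed
  have "((\<lambda>r. \<bar>h (x + s *\<^sub>R \<tau> + r *\<^sub>R \<nu>) - h (x + 0 *\<^sub>R \<tau> + r *\<^sub>R \<nu>) - s * c\<bar>) \<longlongrightarrow> \<bar>0 - 0 - s * c\<bar>) (at_right 0)"
    using s(1) \<open>s < \<delta>\<close> \<open>0 < \<delta>\<close> by (intro tendsto_intros lim0) auto
  moreover have "\<forall>\<^sub>F r in at_right 0. \<bar>h (x + s *\<^sub>R \<tau> + r *\<^sub>R \<nu>) - h (x + 0 *\<^sub>R \<tau> + r *\<^sub>R \<nu>) - s * c\<bar> \<le> s * (\<bar>c\<bar> / 2)"
    using \<mu> est by (auto simp: eventually_at_right_field)
  ultimately have "\<bar>0 - 0 - s * c\<bar> \<le> s * (\<bar>c\<bar> / 2)"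
    by (rule tendsto_upperbound) simp
  then show False using s(1) c by (simp add: abs_mult)
qed

text \<open>
At a boundary point where \<open>S\<close> can be entered in every direction of the open half space \<open>n \<bullet> v < 0\<close>, the
normal cone is the ray spanned by \<open>n\<close>. To see this, a unit normal \<open>m\<close> is split into its component
along \<open>n\<close> and the orthogonal rest \<open>w\<close>. The directions \<open>w - t *\<^sub>R n\<close> with \<open>t > 0\<close> enter \<open>S\<close>, so \<open>m\<close>
is nonpositive on them; letting \<open>t\<close> tend to 0 gives \<open>w \<bullet> w = m \<bullet> w \<le> 0\<close>. The direction \<open>- n\<close> fixes the
sign.
\<close>

lemma is_outer_unit_normalI:
  fixes n :: "'a::real_inner"
  assumes n: "norm n = 1"
    and side: "\<And>y. y \<in> S \<Longrightarrow> n \<bullet> (y - x) \<le> 0"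
    and enter: "\<And>v. n \<bullet> v < 0 \<Longrightarrow> \<exists>r>0. x + r *\<^sub>R v \<in> S"
  shows "is_outer_unit_normal S x n"
  unfolding is_outer_unit_normal_def
proof (intro allI iffI)
  fix m assume m: "norm m = 1 \<and> (\<forall>y\<in>S. m \<bullet> (y - x) \<le> 0)"
  have half: "m \<bullet> v \<le> 0" if v: "n \<bullet> v < 0" for v
  proof -
    obtain r where "r > 0" "x + r *\<^sub>R v \<in> S" using enter[OF v] by blast
    then have "m \<bullet> (r *\<^sub>R v) \<le> 0" using m by force
    then show ?thesis using \<open>r > 0\<close> by (simp add: mult_le_0_iff)
  qed
  have nn: "n \<bullet> n = 1" using n by (simp add: norm_eq_1)
  have mm: "m \<bullet> m = 1" using m by (simp add: norm_eq_1)
  define c where "c = m \<bullet> n"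
  define w where "w = m - c *\<^sub>R n"
  have c0: "c \<ge> 0" using half[of "- n"] nn by (simp add: c_def)
  have nw: "n \<bullet> w = 0" by (simp add: w_def c_def inner_diff_right nn inner_commute)
  have mw: "m \<bullet> w = w \<bullet> w"
    using nw by (simp add: w_def inner_diff_left inner_diff_right algebra_simps inner_commute nn c_def)
  have "w \<bullet> w \<le> s" if "s > 0" for s
  proof -
    define t where "t = s / (c + 1)"
    have t: "t > 0" using that c0 by (simp add: t_def)
    have "n \<bullet> (w - t *\<^sub>R n) < 0" using t by (simp add: inner_diff_right nw nn)
    from half[OF this] have "w \<bullet> w \<le> t * c" by (simp add: inner_diff_right mw c_def)
    also have "\<dots> \<le> s" using that c0 by (simp add: t_def field_simps)
    finally show ?thesis .
  qed
  then have "w \<bullet> w \<le> 0" by (meson dense_ge)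
  then have "w = 0" by (metis inner_eq_zero_iff inner_ge_zero order_antisym)
  then have m_eq: "m = c *\<^sub>R n" by (simp add: w_def)
  then have "c = 1" using m n c0 by simp
  then show "m = n" using m_eq by simp
qed (use n side in auto)

section \<open>Geometry of the regions\<close>

lemma mem_Square: "x \<in> Square a \<longleftrightarrow> a \<le> x$1 \<and> x$1 \<le> a + 1 \<and> a \<le> x$2 \<and> x$2 \<le> a + 1"
  by (auto simp: Square_def mem_box_cart forall_2)

lemma open_above_line: "open {x::real^2. t < x$1 + x$2}"
  by (intro open_Collect_less continuous_intros)

lemma interior_Region2:
  "interior (Region2 a t) = {x. a < x$1 \<and> x$1 < a + 1 \<and> a < x$2 \<and> x$2 < a + 1 \<and> t < x$1 + x$2}"
proof -
  have "Region2 a t = Square a \<inter> {x. t < x$1 + x$2}" by (auto simp: Region2_def)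
  then show ?thesis
    using open_above_line[of t]
    by (auto simp: Square_def interior_open mem_box_cart forall_2)
qed

lemma closure_ray:
  fixes x :: "'a::real_normed_vector"
  assumes "0 < \<delta>" and "\<And>r. 0 < r \<Longrightarrow> r < \<delta> \<Longrightarrow> x + r *\<^sub>R v \<in> S"
  shows "x \<in> closure S"
proof (rule Lim_in_closed_set[of "closure S" "\<lambda>r. x + r *\<^sub>R v" "at_right 0"])
  show "\<forall>\<^sub>F r in at_right 0. x + r *\<^sub>R v \<in> closure S"
    using assms closure_subset[of S] by (auto simp: eventually_at_right_field intro!: exI[of _ \<delta>])
  have "((\<lambda>r. x + r *\<^sub>R v) \<longlongrightarrow> x + 0 *\<^sub>R v) (at_right 0)"
    by (intro tendsto_intros)
  then show "((\<lambda>r. x + r *\<^sub>R v) \<longlongrightarrow> x) (at_right 0)" by simp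
qed auto

lemma open_contains_ray:
  fixes x :: "'a::real_normed_vector"
  assumes "open S" "x \<in> S"
  shows "\<exists>r>0. x + r *\<^sub>R v \<in> S"
proof -
  have "((\<lambda>r. x + r *\<^sub>R v) \<longlongrightarrow> x + 0 *\<^sub>R v) (at_right 0)"
    by (intro tendsto_intros)
  then have "\<forall>\<^sub>F r in at_right 0. x + r *\<^sub>R v \<in> S"
    by (rule topological_tendstoD) (use assms in auto)
  moreover have "\<forall>\<^sub>F r in at_right (0::real). 0 < r"
    by (rule eventually_at_right_less)
  ultimately have "\<forall>\<^sub>F r in at_right (0::real). 0 < r \<and> x + r *\<^sub>R v \<in> S"
    by eventually_elim simp
  then show ?thesis
    using eventually_happens[of _ "at_right (0::real)"] by auto
qed

lemma diagonal_in_frontiers: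
  assumes x: "a < x$1" "x$1 < a + 1" "a < x$2" "x$2 < a + 1" "x$1 + x$2 = t15" and "t05 < t15"
  shows "x \<in> frontier (Region1 a t05 t15) \<inter> frontier (Region2 a t15)"
proof -
  define \<delta> where "\<delta> = min (a + 1 - x$1) (a + 1 - x$2)"
  have \<delta>: "0 < \<delta>" using x by (simp add: \<delta>_def)
  have "x + r *\<^sub>R vec 1 \<in> Region2 a t15" if "0 < r" "r < \<delta>" for r
    using that x by (auto simp: Region2_def mem_Square \<delta>_def)
  then have "x \<in> closure (Region2 a t15)" by (rule closure_ray[OF \<delta>])
  moreover from this have "x \<in> closure (- Region1 a t05 t15)"
    by (rule subsetD[OF closure_mono, rotated]) (auto simp: Region1_def Region2_def)
  moreover have "x \<in> closure (Region1 a t05 t15)" "x \<in> closure (- Region2 a t15)"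
    using x \<open>t05 < t15\<close> by (auto simp: Region1_def Region2_def mem_Square intro!: closure_subset[THEN subsetD])
  ultimately show ?thesis
    by (simp add: frontier_closures)
qed

text \<open>
From a point in the relative interior of the diagonal side, the region is entered in every direction
that increases the coordinate sum, that is, in every direction with negative scalar product with
this normal.
\<close>

lemma diagonal_normal:
  assumes x: "a < x$1" "x$1 < a + 1" "a < x$2" "x$2 < a + 1" "x$1 + x$2 = t15"
  shows "is_outer_unit_normal (interior (Region2 a t15)) x (- (1 / sqrt 2) *\<^sub>R vec 1)"
proof (rule is_outer_unit_normalI)
  have "norm (vec 1 :: real^2) = sqrt 2" by (simp add: norm_eq_sqrt_inner inner_vec_def sum_2)
  then show "norm (- (1 / sqrt 2) *\<^sub>R vec 1 :: real^2) = 1" by simp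
  have inner: "(- (1 / sqrt 2) *\<^sub>R vec 1) \<bullet> v = - (v$1 + v$2) / sqrt 2" for v :: "real^2"
    by (simp add: inner_vec_def sum_2 divide_simps)
  show "(- (1 / sqrt 2) *\<^sub>R vec 1) \<bullet> (y - x) \<le> 0" if "y \<in> interior (Region2 a t15)" for y
    using that x unfolding inner by (auto simp: interior_Region2 divide_le_0_iff)
  fix v :: "real^2" assume "(- (1 / sqrt 2) *\<^sub>R vec 1) \<bullet> v < 0"
  then have v: "v$1 + v$2 > 0" unfolding inner by (simp add: divide_less_0_iff)
  let ?U = "box (vec a) (vec (a + 1)) :: (real^2) set"
  have "x \<in> ?U" using x by (auto simp: mem_box_cart forall_2)
  then obtain r where r: "0 < r" "x + r *\<^sub>R v \<in> ?U"
    using open_contains_ray[OF open_box] by blast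
  have "r * (v$1 + v$2) > 0" using r v by simp
  then have "x + r *\<^sub>R v \<in> interior (Region2 a t15)"
    using r x by (auto simp: interior_Region2 mem_box_cart forall_2 algebra_simps)
  then show "\<exists>r>0. x + r *\<^sub>R v \<in> interior (Region2 a t15)" using r by blast
qed

lemma right_edge_in_frontiers:
  assumes x: "x$1 = a + 1" "a < x$2" "x$2 < a + 1" "t15 < x$1 + x$2"
  shows "x \<in> frontier (Region2 a t15) \<inter> frontier (Square a)"
proof -
  have "x + r *\<^sub>R axis 1 1 \<in> - Square a" if "0 < r" "r < 1" for r
    using that x by (auto simp: mem_Square axis_def)
  then have "x \<in> closure (- Square a)" by (rule closure_ray[of 1, rotated]) auto
  moreover from this have "x \<in> closure (- Region2 a t15)"
    by (rule subsetD[OF closure_mono, rotated]) (auto simp: Region2_def)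
  moreover have "x \<in> closure (Region2 a t15)" "x \<in> closure (Square a)"
    using x by (auto simp: Region2_def mem_Square intro!: closure_subset[THEN subsetD])
  ultimately show ?thesis
    by (simp add: frontier_closures)
qed

lemma right_edge_normal:
  assumes x: "x$1 = a + 1" "a < x$2" "x$2 < a + 1" "t15 < x$1 + x$2"
  shows "is_outer_unit_normal (interior (Region2 a t15)) x (axis 1 1)"
proof (rule is_outer_unit_normalI)
  show "norm (axis 1 1 :: real^2) = 1" by simp
  show "axis 1 1 \<bullet> (y - x) \<le> 0" if "y \<in> interior (Region2 a t15)" for y
    using that x by (auto simp: interior_Region2 inner_axis')
  fix v :: "real^2" assume "axis 1 1 \<bullet> v < 0"
  then have v: "v$1 < 0" by (simp add: inner_axis')
  let ?U = "{x::real^2. a < x$1} \<inter> {x. a < x$2} \<inter> {x. x$2 < a + 1} \<inter> {x. t15 < x$1 + x$2}"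
  have "open ?U" by (intro open_Int open_Collect_less continuous_intros)
  moreover have "x \<in> ?U" using x by auto
  ultimately obtain r where r: "0 < r" "x + r *\<^sub>R v \<in> ?U"
    using open_contains_ray by blast
  have "r * v$1 < 0" using r v by (simp add: mult_pos_neg)
  then have "x + r *\<^sub>R v \<in> interior (Region2 a t15)"
    using r x by (auto simp: interior_Region2)
  then show "\<exists>r>0. x + r *\<^sub>R v \<in> interior (Region2 a t15)" using r by blast
qed

section \<open>Functions of the coordinate sum and complex coordinates\<close>

lemma Uprof_has_derivative:
  assumes "2 * a < t"
  shows "(Uprof a C0 has_real_derivative 3/4 * t - a/2 - 1 / (2 * (t - 2*a))) (at t)"
proof -
  have "((\<lambda>t. 3/8 * t\<^sup>2 - 1/2 * a * t - 1/2 * ln (t - 2 * a) + C0) has_real_derivative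
      3/4 * t - a/2 - 1 / (2 * (t - 2*a))) (at t)"
    using assms by (auto intro!: derivative_eq_intros simp: field_simps)
  moreover have "\<forall>\<^sub>F s in nhds t. 3/8 * s\<^sup>2 - 1/2 * a * s - 1/2 * ln (s - 2 * a) + C0 = Uprof a C0 s"
    using eventually_nhds_in_open[of "{2*a<..}" t] assms
    by (auto simp: Uprof_def elim!: eventually_mono)
  ultimately show ?thesis
    by (subst (asm) DERIV_cong_ev) auto
qed

lemma sum_coords_along_axis:
  fixes i :: 2
  shows "(x + t *\<^sub>R axis i 1) $ 1 + (x + t *\<^sub>R axis i 1) $ 2 = x$1 + x$2 + (t::real)"
  using exhaust_2[of i] by (auto simp: axis_def)

lemma DERIV_sum_coords:
  fixes x :: "real^2"
  assumes "(g has_real_derivative d) (at (x$1 + x$2))"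
  shows "((\<lambda>t. g ((x + t *\<^sub>R axis i 1) $ 1 + (x + t *\<^sub>R axis i 1) $ 2)) has_real_derivative d) (at 0)"
  unfolding sum_coords_along_axis using assms DERIV_shift[of g d 0 "x$1 + x$2"] by (simp add: add.commute)

definition plane_point :: "complex \<Rightarrow> real^2" where
  "plane_point z = vector [Re z, Im z]"

lemma plane_point_nth [simp]: "plane_point z $ 1 = Re z" "plane_point z $ 2 = Im z"
  by (simp_all add: plane_point_def)

lemma plane_point_shift:
  "plane_point (z + t *\<^sub>R 1) = plane_point z + t *\<^sub>R axis 1 1"
  "plane_point (z + t *\<^sub>R \<i>) = plane_point z + t *\<^sub>R axis 2 1"
  by (simp_all add: vec_eq_iff forall_2 axis_def)

lemma plane_point_eq_iff [simp]: "plane_point z = plane_point w \<longleftrightarrow> z = w"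
  by (auto simp: vec_eq_iff forall_2 complex_eq_iff)

lemma continuous_plane_point [continuous_intros]: "continuous_on S plane_point"
  unfolding continuous_on_def
proof (intro ballI vec_tendstoI)
  fix z and i :: 2
  show "((\<lambda>w. plane_point w $ i) \<longlongrightarrow> plane_point z $ i) (at z within S)"
    using exhaust_2[of i] tendsto_Re[OF tendsto_ident_at, of z S] tendsto_Im[OF tendsto_ident_at, of z S]
    by auto
qed

lemma filterlim_plane_point:
  "filterlim plane_point (at (plane_point z) within D) (at z within plane_point -` D)"
proof -
  have "(plane_point \<longlongrightarrow> plane_point z) (at z within plane_point -` D)"
    using continuous_plane_point[of UNIV] by (auto simp: continuous_on_def intro: tendsto_within_subset)
  moreover have "\<forall>\<^sub>F w in at z within plane_point -` D. plane_point w \<in> D \<and> plane_point w \<noteq> plane_point z"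
    by (auto simp: eventually_at_filter)
  ultimately show ?thesis by (simp add: filterlim_at)
qed

section \<open>The boundary conditions are incompatible\<close>

theorem lemma1:
  fixes a t05 t15 C0 :: real and u :: "real^2 \<Rightarrow> real"
  assumes "a > 0"
    and u_nonneg: "\<forall>x\<in>Square a. 0 \<le> u x"
    and u_convex: "convex_on (Square a) u"
    and u_mono: "mono_on (Square a) u"
    and "t05 < t15"
    and "Region0 a t05 \<noteq> {}" and "Region1 a t05 t15 \<noteq> {}" and "Region2 a t15 \<noteq> {}"
    and u_Region0: "\<forall>x\<in>Region0 a t05. u x = 0"
    and u_Region1: "\<forall>x\<in>Region1 a t05 t15. u x = u1 a C0 x"
    and U_zero: "Uprof a C0 t05 = 0"
    and U_deriv_zero: "(Uprof a C0 has_real_derivative 0) (at t05)"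
    and u_strictly_convex: "strictly_convex_on (Region2 a t15) u"
    and u_laplacian: "has_laplacian_on u (\<lambda>_. 3) (interior (Region2 a t15))"
    and u_Neumann:
      "\<forall>x \<in> frontier (Region2 a t15) \<inter> frontier (Square a). \<forall>n.
         is_outer_unit_normal (interior (Region2 a t15)) x n \<longrightarrow>
         (\<exists>p. has_boundary_gradient u (interior (Region2 a t15)) x p \<and> (p - x) \<bullet> n = 0)"
    and u_match_value:
      "\<forall>x \<in> frontier (Region1 a t05 t15) \<inter> frontier (Region2 a t15).
         ((\<lambda>y. u y - u1 a C0 y) \<longlongrightarrow> 0) (at x within interior (Region2 a t15))"
    and u_match_normal_derivative:
      "\<forall>x \<in> frontier (Region1 a t05 t15) \<inter> frontier (Region2 a t15). \<forall>n.
         is_outer_unit_normal (interior (Region2 a t15)) x n \<longrightarrow>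
         (\<exists>p. has_boundary_gradient (\<lambda>y. u y - u1 a C0 y) (interior (Region2 a t15)) x p \<and>
              p \<bullet> n = 0)"
  shows "\<not> C1_up_to_boundary (Square a) u \<and>
         \<not> (\<exists>w. is_profit_maximizer a w \<and> (\<forall>x\<in>Square a. w x = ennreal (u x)))"
proof -
  define D where "D = interior (Region2 a t15)"
  have D: "D = {x. a < x$1 \<and> x$1 < a + 1 \<and> a < x$2 \<and> x$2 < a + 1 \<and> t15 < x$1 + x$2}"
    unfolding D_def by (rule interior_Region2)
  have "open D" by (simp add: D_def)
  have t15: "2 * a < t15" "t15 < 2 * a + 2"
    using \<open>t05 < t15\<close> \<open>Region0 a t05 \<noteq> {}\<close> \<open>Region2 a t15 \<noteq> {}\<close>
    by (auto simp: Region0_def Region2_def mem_Square)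
  obtain F H where partial: "\<And>x i. x \<in> D \<Longrightarrow> has_partial u i (F i x) x"
    and partial2: "\<And>x i. x \<in> D \<Longrightarrow> has_partial (F i) i (H i x) x"
    and lap: "\<And>x. x \<in> D \<Longrightarrow> H 1 x + H 2 x = 3"
    using u_laplacian unfolding has_laplacian_on_def D_def sum_2 by blast
  have u_D: "convex_on D u"
  proof (rule convex_on_subset[OF u_convex])
    show "D \<subseteq> Square a" by (auto simp: D mem_Square)
    show "convex D"
      using u_strictly_convex by (simp add: strictly_convex_on_def D_def convex_interior)
  qed
  have contF: "continuous_on D (F i)" for i
    by (rule convex_directional_derivative_continuous[OF \<open>open D\<close> u_D, where e = "axis i 1"])
       (use partial in \<open>simp add: has_partial_def\<close>)
  have Hpos: "0 \<le> H i x" if "x \<in> D" for i x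
    by (rule convex_second_directional_derivative_nonneg[OF \<open>open D\<close> u_D _ that, where e = "axis i 1" and g = "F i"])
       (use partial partial2 that in \<open>simp_all add: has_partial_def\<close>)

  define U' where "U' t = 3/4 * t - a/2 - 1 / (2 * (t - 2*a))" for t
  \<comment> \<open>The solution with the same Cauchy data on the diagonal, up to a constant: \<open>V' t15 = U' t15\<close>, and
    the Laplacian of \<open>V (x$1 + x$2)\<close> is \<open>2 * V'' = 3\<close>.\<close>
  define V where "V t = U' t15 * t + 3/4 * (t - t15)\<^sup>2" for t
  define V' where "V' t = U' t15 + 3/2 * (t - t15)" for t
  have V: "(V has_real_derivative V' t) (at t)" for t
    unfolding V_def V'_def by (auto intro!: derivative_eq_intros)
  have V'_inj: "V' s = V' t \<longleftrightarrow> s = t" for s t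
    by (simp add: V'_def)
  have V'_der: "(V' has_real_derivative 3/2) (at t)" for t
    unfolding V'_def by (auto intro!: derivative_eq_intros)

  \<comment> \<open>On the diagonal the full gradient of \<open>u\<close> is prescribed: the normal part of the gradient of
    \<open>u - u1\<close> vanishes by assumption, the tangential part because \<open>u - u1\<close> vanishes along it.\<close>
  have diagonal: "(F i \<longlongrightarrow> U' t15) (at x within D)"
    if x: "a < x$1" "x$1 < a + 1" "a < x$2" "x$2 < a + 1" "x$1 + x$2 = t15" for x i
  proof -
    note xT = diagonal_in_frontiers[OF x \<open>t05 < t15\<close>]
    obtain p G where G: "\<And>y. y \<in> D \<Longrightarrow> GDERIV (\<lambda>y. u y - u1 a C0 y) y :> G y"
      and lim: "(G \<longlongrightarrow> p) (at x within D)" and pn: "p \<bullet> (- (1 / sqrt 2) *\<^sub>R vec 1) = 0"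
      using u_match_normal_derivative[rule_format, OF xT diagonal_normal[OF x]]
      unfolding has_boundary_gradient_def D_def by blast
    define \<tau> where "\<tau> = (vector [1, -1] :: real^2)"
    \<comment> \<open>A step along \<open>\<tau>\<close> followed by one along \<open>vec 1\<close> changes each coordinate by less than
      \<open>2 * \<delta>\<close>, so it stays in the square.\<close>
    define \<delta> where "\<delta> = min (min (a + 1 - x$1) (a + 1 - x$2)) (min (x$1 - a) (x$2 - a)) / 2"
    have "p \<bullet> \<tau> = 0"
    proof (rule boundary_gradient_tangential_zero[OF G lim, where \<delta> = \<delta> and \<nu> = "vec 1"])
      show "x \<notin> D" using x by (simp add: D)
      show "0 < \<delta>" using x by (simp add: \<delta>_def)
      show "x + s *\<^sub>R \<tau> + r *\<^sub>R vec 1 \<in> D" if "0 \<le> s" "s < \<delta>" "0 < r" "r < \<delta>" for s r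
        using that x by (auto simp: D \<tau>_def \<delta>_def)
      show "((\<lambda>y. u y - u1 a C0 y) \<longlongrightarrow> 0) (at (x + s *\<^sub>R \<tau>) within D)" if "0 \<le> s" "s < \<delta>" for s
        unfolding D_def
        by (rule u_match_value[rule_format, OF diagonal_in_frontiers])
           (use that x \<open>t05 < t15\<close> in \<open>auto simp: \<tau>_def \<delta>_def\<close>)
      show "vec 1 \<noteq> (0::real^2)" by (simp add: vec_eq_iff)
    qed auto
    then have "p $ i = 0"
      using pn exhaust_2[of i] by (auto simp: inner_vec_def sum_2 \<tau>_def)
    have F_eq: "F i y = G y $ i + U' (y$1 + y$2)" if y: "y \<in> D" for y
    proof -
      have "((\<lambda>t. u (y + t *\<^sub>R axis i 1) - u1 a C0 (y + t *\<^sub>R axis i 1)) has_real_derivative G y \<bullet> axis i 1) (at 0)"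
        using GDERIV_along_line[of "\<lambda>y. u y - u1 a C0 y" y 0 "axis i 1" "G y"] G[OF y] by simp
      moreover have "((\<lambda>t. u1 a C0 (y + t *\<^sub>R axis i 1)) has_real_derivative U' (y$1 + y$2)) (at 0)"
        unfolding u1_def U'_def
        by (intro DERIV_sum_coords Uprof_has_derivative) (use y t15 in \<open>auto simp: D\<close>)
      ultimately have "((\<lambda>t. u (y + t *\<^sub>R axis i 1)) has_real_derivative G y \<bullet> axis i 1 + U' (y$1 + y$2)) (at 0)"
        using DERIV_add by fastforce
      then show ?thesis
        using partial[OF y, of i] DERIV_unique unfolding has_partial_def by (auto simp: inner_axis)
    qed
    have "((\<lambda>y. G y $ i + U' (y$1 + y$2)) \<longlongrightarrow> p $ i + U' (x$1 + x$2)) (at x within D)"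
      unfolding U'_def using t15 x by (intro tendsto_intros lim) auto
    then have "((\<lambda>y. G y $ i + U' (y$1 + y$2)) \<longlongrightarrow> U' t15) (at x within D)"
      using \<open>p $ i = 0\<close> x by simp
    moreover have "\<forall>\<^sub>F y in at x within D. F i y = G y $ i + U' (y$1 + y$2)"
      using F_eq by (auto simp: eventually_at_filter)
    ultimately show ?thesis
      using tendsto_cong by fastforce
  qed

  define Dc where "Dc = plane_point -` D"
  have Dc: "Dc = {z. a < Re z \<and> Re z < a + 1 \<and> a < Im z \<and> Im z < a + 1 \<and> t15 < Re z + Im z}"
    by (auto simp: Dc_def D)
  have "open Dc"
    unfolding Dc_def using \<open>open D\<close> continuous_plane_point by (rule open_vimage)
  define P where "P i z = F i (plane_point z) - V' (Re z + Im z)" for i z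
  have contP: "continuous_on Dc (P i)" for i
    unfolding P_def V'_def
    by (intro continuous_intros continuous_on_compose2[OF contF]) (auto simp: Dc_def)
  have hol: "(\<lambda>z. Complex (P 1 z) (- P 2 z)) holomorphic_on Dc"
  proof (rule harmonic_imp_holomorphic_gradient[where h = "\<lambda>z. u (plane_point z) - V (Re z + Im z)"
        and A = "\<lambda>z. H 1 (plane_point z) - 3/2" and B = "\<lambda>z. H 2 (plane_point z) - 3/2" and C = "3/2"])
    fix z assume "z \<in> Dc"
    then have z: "plane_point z \<in> D" by (simp add: Dc_def)
    note partials = partial[OF z, unfolded has_partial_def] partial2[OF z, unfolded has_partial_def]
    have shift: "((\<lambda>t. g (Re z + t + Im z)) has_real_derivative d) (at 0)"
      "((\<lambda>t. g (Re z + (Im z + t))) has_real_derivative d) (at 0)"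
      if "(g has_real_derivative d) (at (Re z + Im z))" for g :: "real \<Rightarrow> real" and d
      using that DERIV_shift[of g d 0 "Re z + Im z"] by (simp_all add: ac_simps)
    show "((\<lambda>t. u (plane_point (z + t *\<^sub>R 1)) - V (Re (z + t *\<^sub>R 1) + Im (z + t *\<^sub>R 1))) has_real_derivative P 1 z) (at 0)"
      unfolding P_def using DERIV_diff[OF partials(1)[of 1] shift(1)[OF V]] by (simp add: plane_point_shift)
    show "((\<lambda>t. u (plane_point (z + t *\<^sub>R \<i>)) - V (Re (z + t *\<^sub>R \<i>) + Im (z + t *\<^sub>R \<i>))) has_real_derivative P 2 z) (at 0)"
      unfolding P_def using DERIV_diff[OF partials(1)[of 2] shift(2)[OF V]] by (simp add: plane_point_shift)
    show "((\<lambda>t. P 1 (z + t *\<^sub>R 1)) has_real_derivative H 1 (plane_point z) - 3/2) (at 0)"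
      unfolding P_def using DERIV_diff[OF partials(2)[of 1] shift(1)[OF V'_der]] by (simp add: plane_point_shift)
    show "((\<lambda>t. P 2 (z + t *\<^sub>R \<i>)) has_real_derivative H 2 (plane_point z) - 3/2) (at 0)"
      unfolding P_def using DERIV_diff[OF partials(2)[of 2] shift(2)[OF V'_der]] by (simp add: plane_point_shift)
    show "H 1 (plane_point z) - 3/2 + (H 2 (plane_point z) - 3/2) = 0"
      using lap[OF z] by simp
    show "\<bar>H 1 (plane_point z) - 3/2\<bar> \<le> 3/2"
      using lap[OF z] Hpos[OF z, of 1] Hpos[OF z, of 2] by linarith
  qed (use \<open>open Dc\<close> contP in auto)

  define S where "S = box (Complex a a) (Complex (a + 1) (a + 1))"
  have S: "S = {z. a < Re z \<and> Re z < a + 1 \<and> a < Im z \<and> Im z < a + 1}"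
    by (auto simp: S_def in_box_complex_iff)
  have SDc: "S \<inter> {z. t15 < Complex 1 1 \<bullet> z} = Dc"
    by (auto simp: S Dc inner_complex_def)
  have grad0: "Complex (P 1 z) (- P 2 z) = 0" if "z \<in> Dc" for z
  proof (rule holomorphic_zero_of_zero_boundary_values_on_line[of S "Complex 1 1" _ t15 z])
    show "open S" by (simp add: S_def open_box)
    show "connected S" unfolding S_def by (intro convex_connected convex_box)
    show "Complex 1 1 \<noteq> 0" by (simp add: complex_eq_iff)
    \<comment> \<open>As \<open>0 < t15 - 2 * a < 2\<close>, this \<open>m\<close> gives a point of the square below the diagonal.\<close>
    define m where "m = (t15 - 2 * a) / 4"
    have "Complex (a + m) (a + m) \<in> S \<inter> {z. Complex 1 1 \<bullet> z < t15}"
      using t15 by (simp add: S m_def inner_complex_def field_simps)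
    then show "S \<inter> {z. Complex 1 1 \<bullet> z < t15} \<noteq> {}" by blast
    show "((\<lambda>w. Complex (P 1 w) (- P 2 w)) \<longlongrightarrow> 0) (at z within S \<inter> {z. t15 < Complex 1 1 \<bullet> z})"
      if z: "z \<in> S" "Complex 1 1 \<bullet> z = t15" for z
    proof -
      have z': "Re z + Im z = t15" using z(2) by (simp add: inner_complex_def)
      have lim: "(P i \<longlongrightarrow> 0) (at z within Dc)" for i
      proof -
        have "((\<lambda>w. F i (plane_point w)) \<longlongrightarrow> U' t15) (at z within Dc)"
          unfolding Dc_def
          by (rule filterlim_compose[OF diagonal filterlim_plane_point]) (use z(1) z' in \<open>auto simp: S\<close>)
        moreover have "((\<lambda>w. V' (Re w + Im w)) \<longlongrightarrow> U' t15 + 3/2 * (Re z + Im z - t15)) (at z within Dc)"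
          unfolding V'_def by (intro tendsto_intros)
        ultimately have "(P i \<longlongrightarrow> U' t15 - (U' t15 + 3/2 * (Re z + Im z - t15))) (at z within Dc)"
          unfolding P_def by (rule tendsto_diff)
        then show ?thesis using z' by simp
      qed
      have "((\<lambda>w. Complex (P 1 w) (- P 2 w)) \<longlongrightarrow> Complex 0 (- 0)) (at z within Dc)"
        by (intro tendsto_Complex tendsto_minus lim)
      then show ?thesis unfolding SDc by (simp add: zero_complex.code)
    qed
  qed (use hol that in \<open>simp_all add: SDc\<close>)
  have F_D: "F i x = V' (x$1 + x$2)" if x: "x \<in> D" for i x
  proof -
    define z where "z = Complex (x$1) (x$2)"
    have xz: "x = plane_point z" by (simp add: z_def vec_eq_iff forall_2)
    have "P 1 z = 0 \<and> P 2 z = 0"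
      using grad0[of z] x by (simp add: Dc_def xz complex_eq_iff)
    then show ?thesis using exhaust_2[of i] by (auto simp: P_def xz)
  qed

  \<comment> \<open>On the right side the Neumann condition reads \<open>p $ 1 = a + 1\<close>.\<close>
  have edge: "V' (a + 1 + y) = a + 1" if y: "a < y" "y < a + 1" "t15 < a + 1 + y" for y
  proof -
    define x where "x = (vector [a + 1, y] :: real^2)"
    have x: "x$1 = a + 1" "a < x$2" "x$2 < a + 1" "t15 < x$1 + x$2"
      using y by (auto simp: x_def)
    obtain p G where G: "\<And>y. y \<in> D \<Longrightarrow> GDERIV u y :> G y"
      and lim: "(G \<longlongrightarrow> p) (at x within D)" and pn: "(p - x) \<bullet> axis 1 1 = 0"
      using u_Neumann[rule_format, OF right_edge_in_frontiers[OF x] right_edge_normal[OF x]]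
      unfolding has_boundary_gradient_def D_def by blast
    have "G y $ 1 = V' (y$1 + y$2)" if y: "y \<in> D" for y
      using GDERIV_along_line[of u y 0 "axis 1 1" "G y"] G[OF y] partial[OF y, of 1] DERIV_unique F_D[OF y]
      unfolding has_partial_def by (force simp: inner_axis)
    then have "\<forall>\<^sub>F y in at x within D. G y $ 1 = V' (y$1 + y$2)"
      by (auto simp: eventually_at_filter)
    moreover have "((\<lambda>y. G y $ 1) \<longlongrightarrow> p $ 1) (at x within D)"
      by (intro tendsto_intros lim)
    ultimately have "((\<lambda>y. V' (y$1 + y$2)) \<longlongrightarrow> p $ 1) (at x within D)"
      using tendsto_cong by fastforce
    moreover have "((\<lambda>y. V' (y$1 + y$2)) \<longlongrightarrow> V' (x$1 + x$2)) (at x within D)"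
      unfolding V'_def by (intro tendsto_intros)
    moreover have "at x within D \<noteq> bot"
    proof -
      obtain r where "r > 0" "\<And>q. 0 < q \<Longrightarrow> q < r \<Longrightarrow> x + q *\<^sub>R (- axis 1 1) \<in> D"
        using x by (intro that[of "min 1 (x$1 + x$2 - t15)"]) (auto simp: D axis_def)
      then have "x \<in> closure D" by (rule closure_ray)
      moreover have "x \<notin> D" using x by (simp add: D)
      ultimately show ?thesis by (simp add: closure_def trivial_limit_within)
    qed
    ultimately have "p $ 1 = V' (x$1 + x$2)" by (intro tendsto_unique)
    then show ?thesis using pn by (simp add: inner_axis x_def)
  qed
  \<comment> \<open>\<open>y\<close> is the lower end of the right side of the region; the previous fact, at two points above
    it, contradicts the strict monotonicity of \<open>V'\<close>.\<close>
  define y where "y = max a (t15 - a - 1)"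
  have y: "a \<le> y" "t15 \<le> a + 1 + y" "y < a + 1" using t15 by (auto simp: y_def)
  have "V' (a + 1 + (y + (a + 1 - y) / 2)) = a + 1" "V' (a + 1 + (y + (a + 1 - y) / 3)) = a + 1"
    using y by (intro edge; simp add: field_simps)+
  then have "V' (a + 1 + (y + (a + 1 - y) / 2)) = V' (a + 1 + (y + (a + 1 - y) / 3))" by simp
  then have "(a + 1 - y) / 2 = (a + 1 - y) / 3" by (simp only: V'_inj add_left_cancel)
  then have False using y by simp
  then show ?thesis ..
qed

end
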